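(* Let $G$ be a graph with an even number $n\geq 2$ of vertices, and let $\overline{G}$ be its complement. If $\mathrm{mp}(G)+\mathrm{mp}(\overline{G})=n-1$, then $G$ is regular.
   Context: All graphs are finite, simple and undirected; $\overline{G}$ is the complement of $G$. A perfect matching is a set of edges covering every vertex exactly once; an almost-perfect matching is a set of edges covering every vertex except one exactly once and missing the remaining vertex. The matching preclusion number $\mathrm{mp}(G)$ is the minimum number of edges whose deletion leaves a graph with neither a perfect matching nor an almost-perfect matching ($\mathrm{mp}(G)=0$ if $G$ has neither). *)

theory Defs
  imports Main
begin

text \<open>
  A graph is given by its vertex set \<open>V\<close> and its edge set \<open>E\<close>; an (undirected) edge is the
  two-element set of its ends.
\<close>

definition all_edges :: "'a set \<Rightarrow> 'a set set" where
  "all_edges V = {e. e \<subseteq> V \<and> card e = 2}"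

definition simple_graph :: "'a set \<Rightarrow> 'a set set \<Rightarrow> bool" where
  "simple_graph V E \<longleftrightarrow> finite V \<and> E \<subseteq> all_edges V"

definition complement_edges :: "'a set \<Rightarrow> 'a set set \<Rightarrow> 'a set set" where
  "complement_edges V E = all_edges V - E"

definition degree :: "'a set set \<Rightarrow> 'a \<Rightarrow> nat" where
  "degree E v = card {e \<in> E. v \<in> e}"

definition regular :: "'a set \<Rightarrow> 'a set set \<Rightarrow> bool" where
  "regular V E \<longleftrightarrow> (\<exists>d. \<forall>v\<in>V. degree E v = d)"

definition perfect_matching :: "'a set \<Rightarrow> 'a set set \<Rightarrow> 'a set set \<Rightarrow> bool" where
  "perfect_matching V E M \<longleftrightarrow> M \<subseteq> E \<and> (\<forall>v\<in>V. \<exists>!e. e \<in> M \<and> v \<in> e)"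

definition almost_perfect_matching :: "'a set \<Rightarrow> 'a set set \<Rightarrow> 'a set set \<Rightarrow> bool" where
  "almost_perfect_matching V E M \<longleftrightarrow>
     M \<subseteq> E \<and> (\<exists>w\<in>V. (\<forall>e\<in>M. w \<notin> e) \<and> (\<forall>v\<in>V - {w}. \<exists>!e. e \<in> M \<and> v \<in> e))"

definition matching_preclusion_set :: "'a set \<Rightarrow> 'a set set \<Rightarrow> 'a set set \<Rightarrow> bool" where
  "matching_preclusion_set V E F \<longleftrightarrow>
     F \<subseteq> E \<and> (\<nexists>M. perfect_matching V (E - F) M) \<and> (\<nexists>M. almost_perfect_matching V (E - F) M)"

text \<open>
  If \<open>V\<close> has at least two vertices, then \<open>F = E\<close> is a matching preclusion set, so the minimum
  below is attained. (If \<open>V\<close> has at most one vertex, there is no such set, as the empty matching is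
  perfect or almost perfect, and the value of \<open>mp\<close> is meaningless.) If the graph has neither a
  perfect nor an almost-perfect matching, then \<open>F = {}\<close> shows that \<open>mp V E = 0\<close>.
\<close>

definition mp :: "'a set \<Rightarrow> 'a set set \<Rightarrow> nat" where
  "mp V E = (LEAST k. \<exists>F. matching_preclusion_set V E F \<and> card F = k)"

end

theory Submission
  imports Defs
begin

text \<open>
  Deleting all edges at a vertex \<open>v\<close> destroys every perfect matching, and for even order an
  almost-perfect matching never exists; hence \<open>mp\<close> is at most the minimum degree. The minimum degree
  of the complement is \<open>n - 1 - \<Delta>\<close>, so the sum of the two preclusion numbers is at most
  \<open>n - 1 - (\<Delta> - \<delta>)\<close>, and the value \<open>n - 1\<close> forces \<open>\<Delta> = \<delta>\<close>.
\<close>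

lemma finite_all_edges:
  assumes "finite V"
  shows "finite (all_edges V)"
  using assms by (auto simp: all_edges_def intro: finite_subset[of _ "Pow V"])

text \<open>Parity: the edges of \<open>M\<close> would partition \<open>V - {w}\<close> into
  two-element sets, so \<open>card V\<close> would be odd.\<close>

lemma no_almost_perfect_matching:
  assumes "simple_graph V E" and "even (card V)"
  shows "\<not> almost_perfect_matching V E M"
proof
  assume "almost_perfect_matching V E M"
  then obtain w where M: "M \<subseteq> E" and w: "w \<in> V" "\<forall>e\<in>M. w \<notin> e"
    and uniq: "\<forall>v\<in>V - {w}. \<exists>!e. e \<in> M \<and> v \<in> e"
    unfolding almost_perfect_matching_def by blast
  have finV: "finite V" and edge: "\<And>e. e \<in> M \<Longrightarrow> e \<subseteq> V \<and> card e = 2"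
    using assms(1) M by (auto simp: simple_graph_def all_edges_def)
  have sub: "e \<subseteq> V - {w}" if "e \<in> M" for e
    using that edge w(2) by blast
  have cover: "\<Union>M = V - {w}"
  proof
    show "\<Union>M \<subseteq> V - {w}"
      using sub by blast
    show "V - {w} \<subseteq> \<Union>M"
      using uniq by blast
  qed
  \<comment> \<open>A vertex common to two edges of \<open>M\<close> lies in \<open>V - {w}\<close>
    and would be covered twice, against \<open>uniq\<close>.\<close>
  have disj: "pairwise disjnt M"
  proof (rule pairwiseI)
    fix e f assume "e \<in> M" "f \<in> M" "e \<noteq> f"
    show "disjnt e f"
      unfolding disjnt_iff
    proof (intro allI notI, elim conjE)
      fix x assume "x \<in> e" "x \<in> f"
      with \<open>e \<in> M\<close> have "x \<in> V - {w}"
        using sub by blast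
      with uniq have "\<exists>!e. e \<in> M \<and> x \<in> e"
        by (rule bspec)
      with \<open>e \<in> M\<close> \<open>f \<in> M\<close> \<open>x \<in> e\<close> \<open>x \<in> f\<close> \<open>e \<noteq> f\<close> show False
        by blast
    qed
  qed
  have "card (\<Union>M) = sum card M"
    using disj edge finV by (intro card_Union_disjoint) (auto intro: finite_subset)
  also have "\<dots> = card M * 2"
    using edge by simp
  finally have "even (card (V - {w}))"
    unfolding cover by simp
  moreover have "card V = Suc (card (V - {w}))"
    using finV w(1) by (simp only: card_Suc_Diff1)
  ultimately show False
    using assms(2) by simp
qed

lemma mp_le_degree:
  assumes "simple_graph V E" and "even (card V)" and "v \<in> V"
  shows "mp V E \<le> degree E v"
proof -
  let ?F = "{e \<in> E. v \<in> e}"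
  \<comment> \<open>The parity lemma is applied to the graph that remains after the deletion, on the
    same vertex set.\<close>
  have "simple_graph V (E - ?F)"
    using assms(1) by (auto simp: simple_graph_def)
  then have "\<nexists>M. almost_perfect_matching V (E - ?F) M"
    using no_almost_perfect_matching assms(2) by blast
  \<comment> \<open>No edge of \<open>E - ?F\<close> contains \<open>v\<close>, so \<open>v\<close>
    stays uncovered.\<close>
  moreover have "\<nexists>M. perfect_matching V (E - ?F) M"
    using assms(3) unfolding perfect_matching_def by blast
  ultimately have "matching_preclusion_set V E ?F"
    by (auto simp: matching_preclusion_set_def)
  then show ?thesis
    unfolding mp_def degree_def by (blast intro: Least_le)
qed

text \<open>An edge at \<open>v\<close> is determined by its other end, which ranges over
  \<open>V - {v}\<close>.\<close>

lemma degree_all_edges: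
  assumes "v \<in> V"
  shows "degree (all_edges V) v = card V - 1"
proof -
  have "{e \<in> all_edges V. v \<in> e} = (\<lambda>u. {v, u}) ` (V - {v})"
  proof (intro equalityI subsetI)
    fix e assume "e \<in> {e \<in> all_edges V. v \<in> e}"
    then have e: "e \<subseteq> V" "card e = 2" "v \<in> e"
      by (simp_all add: all_edges_def)
    then obtain u where "e = {v, u}" "u \<noteq> v"
      by (metis card_2_iff insert_commute insertE singletonD)
    with e(1) show "e \<in> (\<lambda>u. {v, u}) ` (V - {v})"
      by blast
  next
    fix e assume "e \<in> (\<lambda>u. {v, u}) ` (V - {v})"
    then obtain u where "e = {v, u}" "u \<in> V" "u \<noteq> v"
      by blast
    with assms show "e \<in> {e \<in> all_edges V. v \<in> e}"
      by (simp add: all_edges_def)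
  qed
  moreover have "inj_on (\<lambda>u. {v, u}) (V - {v})"
    by (auto simp: inj_on_def doubleton_eq_iff)
  ultimately show ?thesis
    using assms by (simp add: degree_def card_image)
qed

lemma degree_complement_edges:
  assumes "simple_graph V E" and "v \<in> V"
  shows "degree E v + degree (complement_edges V E) v = card V - 1"
proof -
  have E: "E \<subseteq> all_edges V" and fin: "finite (all_edges V)"
    using assms(1) finite_all_edges by (auto simp: simple_graph_def)
  have "degree (all_edges V) v = card ({e \<in> E. v \<in> e} \<union> {e \<in> complement_edges V E. v \<in> e})"
    unfolding degree_def complement_edges_def using E by (intro arg_cong[of _ _ card]) blast
  also have "\<dots> = degree E v + degree (complement_edges V E) v"
    unfolding degree_def complement_edges_def using E fin
    by (intro card_Un_disjoint) (auto intro: finite_subset)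
  finally show ?thesis
    using degree_all_edges[OF assms(2)] by simp
qed

theorem theorem5p5:
  fixes V :: "'a set" and E :: "'a set set"
  assumes "simple_graph V E"
    and "even (card V)"
    and "card V \<ge> 2"
    and "mp V E + mp V (complement_edges V E) = card V - 1"
  shows "regular V E"
proof -
  have comp: "simple_graph V (complement_edges V E)"
    using assms(1) by (auto simp: simple_graph_def complement_edges_def)
  \<comment> \<open>Arbitrary \<open>u\<close> and \<open>v\<close> replace the vertices of extreme
    degree: bounding \<open>mp\<close> of the graph at \<open>v\<close> and \<open>mp\<close> of the
    complement at \<open>u\<close> gives n - 1 \<le> \<open>degree E v\<close> + (n - 1 -
    \<open>degree E u\<close>), where n = \<open>card V\<close>. Exchanging \<open>u\<close> and
    \<open>v\<close> then yields equality.\<close>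
  have le: "degree E u \<le> degree E v" if "u \<in> V" "v \<in> V" for u v
    using mp_le_degree[OF assms(1,2) that(2)] mp_le_degree[OF comp assms(2) that(1)]
      degree_complement_edges[OF assms(1) that(1)] assms(4)
    by linarith
  then have eq: "degree E u = degree E v" if "u \<in> V" "v \<in> V" for u v
    using that le_antisym by blast
  obtain v where "v \<in> V"
    using assms(3) by fastforce
  then show ?thesis
    unfolding regular_def using eq by blast
qed

end
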